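(* Let $H$ be a hypergraph. The function defined on $2^{V(H)}$ which maps each $W\subseteq V(H)$ to the set $\mathscr{M}(H[W])$ of the modules of the induced subhypergraph $H[W]$ is a modular covering of $V(H)$.
   Context: All structures are finite. A hypergraph $H$ consists of a vertex set $V(H)$ and an edge set $E(H)$ which is a set of subsets of $V(H)$, each having at least $2$ elements (edges may have different sizes). For $W\subseteq V(H)$, $H[W]$ is the hypergraph with $V(H[W])=W$ and $E(H[W])=\{e\in E(H):e\subseteq W\}$. A subset $M$ of $V(H)$ is a module of $H$ if for each $e\in E(H)$ such that $e\cap M\neq\emptyset$ and $e\setminus M\neq\emptyset$, there exists $m\in M$ such that $e\cap M=\{m\}$ and for every $n\in M$, $(e\setminus\{m\})\cup\{n\}\in E(H)$. The set of modules of $H$ is denoted by $\mathscr{M}(H)$. A family $\mathscr{F}$ of subsets of a set $S$ is a partitive family on $S$ if: (i) $\emptyset\in\mathscr{F}$, $S\in\mathscr{F}$, and $\{x\}\in\mathscr{F}$ for every $x\in S$; (ii) for any $M,N\in\mathscr{F}$, $M\cap N\in\mathscr{F}$; (iii) for any $M,N\in\mathscr{F}$, if $M\cap N\neq\emptyset$, $M\setminus N\neq\emptyset$ and $N\setminus M\neq\emptyset$, then $M\cup N\in\mathscr{F}$ and $(M\setminus N)\cup(N\setminus M)\in\mathscr{F}$. A modular covering of a set $S$ is a function $\mathfrak{M}$ which associates with each $W\subseteq S$ a set $\mathfrak{M}(W)$ of subsets of $W$, and which satisfies: (A1) for each $W\subseteq S$, $\mathfrak{M}(W)$ is a partitive family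 on $W$; (A2) for any $W\subseteq W'\subseteq S$, $\{M'\cap W:M'\in\mathfrak{M}(W')\}\subseteq\mathfrak{M}(W)$; (A3) for any $W\subseteq W'\subseteq S$, if $W\in\mathfrak{M}(W')$, then $\{M'\in\mathfrak{M}(W'):M'\subseteq W\}=\mathfrak{M}(W)$; (A4) for any $W\subseteq W'\subseteq S$, $M\in\mathfrak{M}(W)$ and $M'\in\mathfrak{M}(W')$, if $M\cap M'=\emptyset$ and $M'\cap W\neq\emptyset$, then $M\in\mathfrak{M}(W\cup M')$; (A5) for any $W\subseteq W'\subseteq S$, $M\in\mathfrak{M}(W)$ and $M'\in\mathfrak{M}(W')$, if $M\cap M'\neq\emptyset$, then $M\cup M'\in\mathfrak{M}(W\cup M')$. *)

theory Defs
  imports Main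
begin

record 'a hgraph =
  verts :: "'a set"
  edges :: "'a set set"

definition hypergraph :: "'a hgraph \<Rightarrow> bool" where
  "hypergraph H \<longleftrightarrow>
     finite (verts H) \<and> (\<forall>e\<in>edges H. e \<subseteq> verts H \<and> 2 \<le> card e)"

definition induced :: "'a hgraph \<Rightarrow> 'a set \<Rightarrow> 'a hgraph" where
  "induced H W = \<lparr>verts = W, edges = {e \<in> edges H. e \<subseteq> W}\<rparr>"

definition is_module :: "'a hgraph \<Rightarrow> 'a set \<Rightarrow> bool" where
  "is_module H M \<longleftrightarrow>
     M \<subseteq> verts H \<and>
     (\<forall>e\<in>edges H. e \<inter> M \<noteq> {} \<and> e - M \<noteq> {} \<longrightarrow>
        (\<exists>m\<in>M. e \<inter> M = {m} \<and> (\<forall>n\<in>M. (e - {m}) \<union> {n} \<in> edges H)))"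

definition modules :: "'a hgraph \<Rightarrow> 'a set set" where
  "modules H = {M. is_module H M}"

definition partitive_family :: "'a set \<Rightarrow> 'a set set \<Rightarrow> bool" where
  "partitive_family S F \<longleftrightarrow>
     F \<subseteq> Pow S \<and>
     {} \<in> F \<and> S \<in> F \<and> (\<forall>x\<in>S. {x} \<in> F) \<and>
     (\<forall>M\<in>F. \<forall>N\<in>F. M \<inter> N \<in> F) \<and>
     (\<forall>M\<in>F. \<forall>N\<in>F. M \<inter> N \<noteq> {} \<and> M - N \<noteq> {} \<and> N - M \<noteq> {} \<longrightarrow>
        M \<union> N \<in> F \<and> (M - N) \<union> (N - M) \<in> F)"

(* A function with domain 2^S is represented by a total function on sets, of which
   only the values at subsets of S are constrained. That C W consists of subsets of W
   is part of partitive_family W (C W). *)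
definition modular_covering :: "'a set \<Rightarrow> ('a set \<Rightarrow> 'a set set) \<Rightarrow> bool" where
  "modular_covering S C \<longleftrightarrow>
     (\<forall>W. W \<subseteq> S \<longrightarrow> partitive_family W (C W)) \<and>
     (\<forall>W W'. W \<subseteq> W' \<and> W' \<subseteq> S \<longrightarrow> {M' \<inter> W |M'. M' \<in> C W'} \<subseteq> C W) \<and>
     (\<forall>W W'. W \<subseteq> W' \<and> W' \<subseteq> S \<and> W \<in> C W' \<longrightarrow> {M' \<in> C W'. M' \<subseteq> W} = C W) \<and>
     (\<forall>W W'. W \<subseteq> W' \<and> W' \<subseteq> S \<longrightarrow>
        (\<forall>M\<in>C W. \<forall>M'\<in>C W'. M \<inter> M' = {} \<and> M' \<inter> W \<noteq> {} \<longrightarrow> M \<in> C (W \<union> M'))) \<and>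
     (\<forall>W W'. W \<subseteq> W' \<and> W' \<subseteq> S \<longrightarrow>
        (\<forall>M\<in>C W. \<forall>M'\<in>C W'. M \<inter> M' \<noteq> {} \<longrightarrow> M \<union> M' \<in> C (W \<union> M')))"

end

(* The key tool is that an edge meeting a module M without being contained in it meets M in
   one vertex, which can be exchanged for any other vertex of M.  In (A4) and (A5), an edge of
   W \<union> M' that leaves W meets M' in one vertex; exchanging it for a vertex of M' \<inter> W gives an
   edge inside W, to which the module M of H[W] applies, and one then exchanges back.  Closure
   of modules under overlapping unions is the case W = W' of (A5).  For the symmetric
   difference, exchanges show that the only edges not handled by the union are pairs. *)

theory Submission
  imports Defs
begin

section \<open>The module condition in terms of single vertices\<close>

text \<open>Since \<open>e\<close> meets \<open>M\<close> in one vertex, the existential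
  \<open>m\<close> of \<open>is_module\<close> is any given vertex of \<open>e\<close> in
  \<open>M\<close>; \<open>x\<close> witnesses that \<open>e\<close> leaves \<open>M\<close>.
  Exchanged edges stay inside \<open>W\<close> because \<open>M \<subseteq> W\<close>, so only
  membership in \<open>edges H\<close> is recorded.\<close>

lemma mem_modules_induced_iff:
  "M \<in> modules (induced H W) \<longleftrightarrow> M \<subseteq> W \<and>
     (\<forall>e m x. e \<in> edges H \<and> e \<subseteq> W \<and> m \<in> e \<and> m \<in> M \<and> x \<in> e \<and> x \<notin> M \<longrightarrow>
        e \<inter> M = {m} \<and> (\<forall>n\<in>M. insert n (e - {m}) \<in> edges H))"
  (is "?L \<longleftrightarrow> ?R")
proof
  assume L: ?L
  have "e \<inter> M = {m} \<and> (\<forall>n\<in>M. insert n (e - {m}) \<in> edges H)"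
    if e: "e \<in> edges H" "e \<subseteq> W" "m \<in> e" "m \<in> M" "x \<in> e" "x \<notin> M" for e m x
  proof -
    have "e \<inter> M \<noteq> {}" "e - M \<noteq> {}" using e by auto
    then obtain m' where m': "e \<inter> M = {m'}" "\<forall>n\<in>M. (e - {m'}) \<union> {n} \<in> edges H"
      using L e by (auto simp: modules_def is_module_def induced_def)
    then have "m' = m" using e by auto
    then show ?thesis using m' by auto
  qed
  then show ?R using L by (auto simp: modules_def is_module_def induced_def)
next
  assume R: ?R
  have "\<exists>m\<in>M. e \<inter> M = {m} \<and> (\<forall>n\<in>M. (e - {m}) \<union> {n} \<in> edges H \<and> (e - {m}) \<union> {n} \<subseteq> W)"
    if e: "e \<in> edges H" "e \<subseteq> W" "e \<inter> M \<noteq> {}" "e - M \<noteq> {}" for e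
  proof -
    obtain m x where mx: "m \<in> e" "m \<in> M" "x \<in> e" "x \<notin> M" using e by auto
    then have "e \<inter> M = {m}" "\<forall>n\<in>M. insert n (e - {m}) \<in> edges H" using R e by blast+
    moreover have "M \<subseteq> W" using R by blast
    ultimately show ?thesis using e(2) mx(2) by (intro bexI[of _ m]) auto
  qed
  then show ?L using R by (simp add: modules_def is_module_def induced_def)
qed

lemma modules_inducedI:
  assumes "M \<subseteq> W"
    and "\<And>e m x. \<lbrakk>e \<in> edges H; e \<subseteq> W; m \<in> e; m \<in> M; x \<in> e; x \<notin> M\<rbrakk> \<Longrightarrow>
           e \<inter> M = {m} \<and> (\<forall>n\<in>M. insert n (e - {m}) \<in> edges H)"
  shows "M \<in> modules (induced H W)"
  using assms unfolding mem_modules_induced_iff by blast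

lemma modules_induced_subset: "M \<in> modules (induced H W) \<Longrightarrow> M \<subseteq> W"
  by (simp add: mem_modules_induced_iff)

lemma modules_induced_Int_eq:
  "\<lbrakk>M \<in> modules (induced H W); e \<in> edges H; e \<subseteq> W; m \<in> e; m \<in> M; x \<in> e; x \<notin> M\<rbrakk> \<Longrightarrow>
     e \<inter> M = {m}"
  unfolding mem_modules_induced_iff by blast

lemma modules_induced_exchange:
  "\<lbrakk>M \<in> modules (induced H W); e \<in> edges H; e \<subseteq> W; m \<in> e; m \<in> M; x \<in> e; x \<notin> M; n \<in> M\<rbrakk> \<Longrightarrow>
     insert n (e - {m}) \<in> edges H"
  unfolding mem_modules_induced_iff by blast

section \<open>Trivial modules, intersections, restriction and transitivity\<close>

lemma modules_induced_trivial:
  "{} \<in> modules (induced H W)" "W \<in> modules (induced H W)"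
  "x \<in> W \<Longrightarrow> {x} \<in> modules (induced H W)"
  by (auto simp: mem_modules_induced_iff insert_absorb)

lemma modules_induced_Int:
  assumes M: "M \<in> modules (induced H W)" and N: "N \<in> modules (induced H W)"
  shows "M \<inter> N \<in> modules (induced H W)"
proof (rule modules_inducedI)
  show "M \<inter> N \<subseteq> W" using modules_induced_subset[OF M] by blast
next
  fix e m x
  assume e: "e \<in> edges H" "e \<subseteq> W" "m \<in> e" "m \<in> M \<inter> N" "x \<in> e" "x \<notin> M \<inter> N"
  \<comment> \<open>\<open>K\<close> stands for whichever of \<open>M\<close> and \<open>N\<close>
    misses \<open>x\<close>; this module alone supplies both the single vertex and the
    exchanges.\<close>
  have "e \<inter> (M \<inter> N) = {m} \<and> (\<forall>n\<in>M \<inter> N. insert n (e - {m}) \<in> edges H)"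
    if K: "K \<in> modules (induced H W)" "m \<in> K" "M \<inter> N \<subseteq> K" "x \<notin> K" for K
    using modules_induced_Int_eq[OF K(1) e(1-3) K(2) e(5) K(4)]
      modules_induced_exchange[OF K(1) e(1-3) K(2) e(5) K(4)] K(3) e(4) by blast
  from this[OF M] this[OF N] e
  show "e \<inter> (M \<inter> N) = {m} \<and> (\<forall>n\<in>M \<inter> N. insert n (e - {m}) \<in> edges H)" by blast
qed

lemma modules_induced_restrict:
  assumes M: "M \<in> modules (induced H W')" and W: "W \<subseteq> W'"
  shows "M \<inter> W \<in> modules (induced H W)"
proof (rule modules_inducedI)
  fix e m x
  assume e: "e \<in> edges H" "e \<subseteq> W" "m \<in> e" "m \<in> M \<inter> W" "x \<in> e" "x \<notin> M \<inter> W"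
  then have "e \<subseteq> W'" "m \<in> M" "x \<notin> M" using W by auto
  with modules_induced_Int_eq[OF M] modules_induced_exchange[OF M] e
  show "e \<inter> (M \<inter> W) = {m} \<and> (\<forall>n\<in>M \<inter> W. insert n (e - {m}) \<in> edges H)" by blast
qed simp

text \<open>This is the inclusion of (A3) that does not come from restriction. An edge inside
  \<open>W\<close> is governed by \<open>M\<close>; an edge leaving \<open>W\<close> is governed by
  \<open>W\<close> itself, whose exchanges include those within \<open>M\<close>.\<close>

lemma modules_induced_trans:
  assumes W: "W \<in> modules (induced H W')" and M: "M \<in> modules (induced H W)"
  shows "M \<in> modules (induced H W')"
proof (rule modules_inducedI)
  show "M \<subseteq> W'" using modules_induced_subset[OF W] modules_induced_subset[OF M] by blast
next
  fix e m x
  assume e: "e \<in> edges H" "e \<subseteq> W'" "m \<in> e" "m \<in> M" "x \<in> e" "x \<notin> M"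
  show "e \<inter> M = {m} \<and> (\<forall>n\<in>M. insert n (e - {m}) \<in> edges H)"
  proof (cases "e \<subseteq> W")
    case True
    then show ?thesis
      using modules_induced_Int_eq[OF M] modules_induced_exchange[OF M] e by blast
  next
    case False
    then obtain y where y: "y \<in> e" "y \<notin> W" by blast
    have MW: "M \<subseteq> W" by (rule modules_induced_subset[OF M])
    then have mW: "m \<in> W" using e by blast
    show ?thesis
      using modules_induced_Int_eq[OF W e(1-3) mW y]
        modules_induced_exchange[OF W e(1-3) mW y] MW e by blast
  qed
qed

section \<open>Enlarging the ambient set: (A4) and (A5)\<close>

lemma modules_induced_extend_disjoint:
  assumes M: "M \<in> modules (induced H W)" and M': "M' \<in> modules (induced H W')"
    and W: "W \<subseteq> W'" and disj: "M \<inter> M' = {}" and p: "p \<in> M'" "p \<in> W"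
  shows "M \<in> modules (induced H (W \<union> M'))"
proof (rule modules_inducedI)
  show "M \<subseteq> W \<union> M'" using modules_induced_subset[OF M] by blast
next
  fix e m x
  assume e: "e \<in> edges H" "e \<subseteq> W \<union> M'" "m \<in> e" "m \<in> M" "x \<in> e" "x \<notin> M"
  have MW: "M \<subseteq> W" by (rule modules_induced_subset[OF M])
  have WW: "W \<union> M' \<subseteq> W'" using W modules_induced_subset[OF M'] by blast
  have mM': "m \<notin> M'" using e disj by blast
  show "e \<inter> M = {m} \<and> (\<forall>n\<in>M. insert n (e - {m}) \<in> edges H)"
  proof (cases "e \<subseteq> W")
    case True
    then show ?thesis
      using modules_induced_Int_eq[OF M] modules_induced_exchange[OF M] e by blast
  next
    case False
    then obtain q where q: "q \<in> e" "q \<in> M'" using e by blast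
    have eW': "e \<subseteq> W'" using e WW by blast
    have eM': "e \<inter> M' = {q}"
      by (rule modules_induced_Int_eq[OF M' e(1) eW' q e(3) mM'])
    \<comment> \<open>Replacing \<open>q\<close>, the only vertex of \<open>e\<close> in
      \<open>M'\<close>, by \<open>p\<close> moves the edge into \<open>W\<close>. As
      \<open>x\<close> may be \<open>q\<close>, it is now \<open>p\<close> that witnesses that the
      edge leaves \<open>M\<close>.\<close>
    let ?f = "insert p (e - {q})"
    have f: "?f \<in> edges H"
      by (rule modules_induced_exchange[OF M' e(1) eW' q e(3) mM' p(1)])
    have fW: "?f \<subseteq> W" and mf: "m \<in> ?f" and pf: "p \<in> ?f" and pM: "p \<notin> M"
      using e q eM' p disj by auto
    have fM: "?f \<inter> M = {m}"
      by (rule modules_induced_Int_eq[OF M f fW mf e(4) pf pM])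
    have "insert n (e - {m}) \<in> edges H" if n: "n \<in> M" for n
    proof -
      let ?g = "insert n (?f - {m})"
      have g: "?g \<in> edges H"
        by (rule modules_induced_exchange[OF M f fW mf e(4) pf pM n])
      have gW: "?g \<subseteq> W'" and pg: "p \<in> ?g" and ng: "n \<in> ?g" and nM': "n \<notin> M'"
        using fW MW WW n e pM disj by auto
      \<comment> \<open>Exchanging back: \<open>n\<close> lies outside \<open>M'\<close>, so
        \<open>?g\<close> leaves \<open>M'\<close> and \<open>p\<close> may be replaced by
        \<open>q\<close>.\<close>
      have "insert q (?g - {p}) \<in> edges H"
        by (rule modules_induced_exchange[OF M' g gW pg p(1) ng nM' q(2)])
      moreover have "insert q (?g - {p}) = insert n (e - {m})"
        using q eM' mM' nM' p by auto
      ultimately show ?thesis by simp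
    qed
    moreover have "?f \<inter> M = e \<inter> M" using q disj pM by auto
    then have "e \<inter> M = {m}" using fM by simp
    ultimately show ?thesis by blast
  qed
qed

text \<open>The common vertex \<open>p\<close> links the two modules: an exchange in one of them
  brings in \<open>p\<close>, which an exchange in the other replaces. Which module comes first
  depends on whether \<open>e\<close> meets \<open>M'\<close>.\<close>

lemma modules_induced_Un:
  assumes M: "M \<in> modules (induced H W)" and M': "M' \<in> modules (induced H W')"
    and W: "W \<subseteq> W'" and p: "p \<in> M" "p \<in> M'"
  shows "M \<union> M' \<in> modules (induced H (W \<union> M'))"
proof (rule modules_inducedI)
  show "M \<union> M' \<subseteq> W \<union> M'" using modules_induced_subset[OF M] by blast
next
  fix e m x
  assume e: "e \<in> edges H" "e \<subseteq> W \<union> M'" "m \<in> e" "m \<in> M \<union> M'" "x \<in> e" "x \<notin> M \<union> M'"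
  have MW: "M \<subseteq> W" by (rule modules_induced_subset[OF M])
  have WW: "W \<union> M' \<subseteq> W'" using W modules_induced_subset[OF M'] by blast
  have eW': "e \<subseteq> W'" using e WW by blast
  have x: "x \<notin> M" "x \<notin> M'" using e by auto
  let ?f = "insert p (e - {m})"
  show "e \<inter> (M \<union> M') = {m} \<and> (\<forall>n\<in>M \<union> M'. insert n (e - {m}) \<in> edges H)"
  proof (cases "e \<inter> M' = {}")
    case False
    then obtain q where q: "q \<in> e" "q \<in> M'" by blast
    have eM': "e \<inter> M' = {q}"
      by (rule modules_induced_Int_eq[OF M' e(1) eW' q e(5) x(2)])
    let ?f = "insert p (e - {q})"
    have f: "?f \<in> edges H"
      by (rule modules_induced_exchange[OF M' e(1) eW' q e(5) x(2) p(2)])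
    have fW: "?f \<subseteq> W" and pf: "p \<in> ?f" and xf: "x \<in> ?f"
      using e q eM' p MW by auto
    have fM: "?f \<inter> M = {p}"
      by (rule modules_induced_Int_eq[OF M f fW pf p(1) xf x(1)])
    \<comment> \<open>If \<open>p\<close> is in \<open>e\<close>, it is \<open>q\<close>. Hence
      \<open>?f \<inter> M = {p}\<close> says that the rest of \<open>e\<close> misses
      \<open>M\<close>, and \<open>q\<close> is the only vertex of \<open>e\<close> in the
      union.\<close>
    have pe: "p \<notin> e - {q}" using eM' p by auto
    then have "(e - {q}) \<inter> M = {}" using fM by auto
    then have eq: "e \<inter> (M \<union> M') = {q}" using eM' by auto
    moreover have "q = m" using eq e(3,4) by auto
    moreover have "insert n (e - {q}) \<in> edges H" if "n \<in> M'" for n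
      by (rule modules_induced_exchange[OF M' e(1) eW' q e(5) x(2) that])
    moreover have "insert n (e - {q}) \<in> edges H" if "n \<in> M" for n
    proof -
      have "insert n (?f - {p}) \<in> edges H"
        by (rule modules_induced_exchange[OF M f fW pf p(1) xf x(1) that])
      moreover have "?f - {p} = e - {q}" using pe by simp
      ultimately show ?thesis by simp
    qed
    ultimately show ?thesis by blast
  next
    case True
    then have eW: "e \<subseteq> W" and mM: "m \<in> M" using e by auto
    have eM: "e \<inter> M = {m}"
      by (rule modules_induced_Int_eq[OF M e(1) eW e(3) mM e(5) x(1)])
    have f: "?f \<in> edges H"
      by (rule modules_induced_exchange[OF M e(1) eW e(3) mM e(5) x(1) p(1)])
    have fW': "?f \<subseteq> W'" and pf: "p \<in> ?f" and xf: "x \<in> ?f"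
      using e eW' p MW W mM x by auto
    \<comment> \<open>Two exchanges, \<open>m\<close> for \<open>p\<close> in \<open>M\<close> and
      then \<open>p\<close> for \<open>n\<close> in \<open>M'\<close>, both with \<open>x\<close> as
      the outside vertex.\<close>
    have "insert n (e - {m}) \<in> edges H" if "n \<in> M'" for n
    proof -
      have "insert n (?f - {p}) \<in> edges H"
        by (rule modules_induced_exchange[OF M' f fW' pf p(2) xf x(2) that])
      moreover have "?f - {p} = e - {m}" using True p by auto
      ultimately show ?thesis by simp
    qed
    moreover have "insert n (e - {m}) \<in> edges H" if "n \<in> M" for n
      by (rule modules_induced_exchange[OF M e(1) eW e(3) mM e(5) x(1) that])
    moreover have "e \<inter> (M \<union> M') = {m}" using eM True by (simp add: Int_Un_distrib)
    ultimately show ?thesis by blast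
  qed
qed

section \<open>Symmetric differences\<close>

lemma modules_induced_exchange_pair:
  assumes "M \<in> modules (induced H W)" "{a, m} \<in> edges H"
    and "a \<in> W" "a \<notin> M" "m \<in> M" "n \<in> M"
  shows "{a, n} \<in> edges H"
proof -
  have "{a, m} \<subseteq> W" using assms modules_induced_subset by blast
  then have "insert n ({a, m} - {m}) \<in> edges H"
    using modules_induced_exchange[OF assms(1,2), of m a n] assms by simp
  moreover have "insert n ({a, m} - {m}) = {a, n}" using assms by auto
  ultimately show ?thesis by simp
qed

text \<open>This treats the edges inside \<open>M \<union> N\<close> that meet both the symmetric
  difference and the intersection. Such an edge meets \<open>N\<close> only in \<open>p\<close>;
  replacing \<open>p\<close> by some \<open>q\<close> in \<open>N - M\<close> makes it leave
  \<open>M\<close>, so it meets \<open>M\<close> only in \<open>m\<close>, and nothing but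
  \<open>m\<close> and \<open>p\<close> remains.\<close>

lemma modules_induced_straddling_pair:
  assumes M: "M \<in> modules (induced H W)" and N: "N \<in> modules (induced H W)"
    and ne: "N - M \<noteq> {}"
    and e: "e \<in> edges H" "e \<subseteq> M \<union> N" "m \<in> e" "m \<in> M - N" "p \<in> e" "p \<in> M \<inter> N"
  shows "e = {m, p}" and "\<And>n. n \<in> (M - N) \<union> (N - M) \<Longrightarrow> {p, n} \<in> edges H"
proof -
  have MW: "M \<subseteq> W" and NW: "N \<subseteq> W" using M N by (auto dest: modules_induced_subset)
  obtain q where q: "q \<in> N" "q \<notin> M" using ne by blast
  have eW: "e \<subseteq> W" using e MW NW by blast
  have pN: "p \<in> N" and mN: "m \<notin> N" using e by auto
  have eN: "e \<inter> N = {p}" by (rule modules_induced_Int_eq[OF N e(1) eW e(5) pN e(3) mN])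
  let ?f = "insert q (e - {p})"
  have f: "?f \<in> edges H"
    by (rule modules_induced_exchange[OF N e(1) eW e(5) pN e(3) mN q(1)])
  have fW: "?f \<subseteq> W" and mf: "m \<in> ?f" and qf: "q \<in> ?f" and mM: "m \<in> M"
    using eW q NW e by auto
  have fM: "?f \<inter> M = {m}"
    by (rule modules_induced_Int_eq[OF M f fW mf mM qf q(2)])
  \<comment> \<open>Such a \<open>y\<close> is outside \<open>N\<close>, hence in \<open>M\<close>,
    and it survives the exchange of \<open>p\<close> for \<open>q\<close>.\<close>
  have "y = m" if "y \<in> e" "y \<noteq> p" for y
  proof -
    have "y \<notin> N" using eN that by auto
    then have "y \<in> ?f \<inter> M" using e(2) that by auto
    then show ?thesis using fM by simp
  qed
  then show em: "e = {m, p}" using e(3,5) by auto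
  have in_W: "m \<in> W" "p \<in> W" "q \<in> W" using e(3,5) eW q(1) NW by auto
  have pM: "p \<in> M" using e(6) by simp
  have mp: "{m, p} \<in> edges H" using e(1) unfolding em .
  have mN': "{r, m} \<in> edges H" if "r \<in> N" for r
    using modules_induced_exchange_pair[OF N mp in_W(1) mN pN that] by (simp add: insert_commute)
  fix n assume n: "n \<in> (M - N) \<union> (N - M)"
  show "{p, n} \<in> edges H"
  proof (cases "n \<in> M")
    \<comment> \<open>Here \<open>n\<close> is in \<open>M - N\<close>: the pair
      \<open>{q, m}\<close> becomes \<open>{q, n}\<close> by an exchange in \<open>M\<close>, then
      \<open>{p, n}\<close> by one in \<open>N\<close>.\<close>
    case True
    then have nN: "n \<notin> N" and nW: "n \<in> W" using n MW by auto
    have "{q, n} \<in> edges H"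
      by (rule modules_induced_exchange_pair[OF M mN'[OF q(1)] in_W(3) q(2) mM True])
    then have "{n, q} \<in> edges H" by (simp add: insert_commute)
    from modules_induced_exchange_pair[OF N this nW nN q(1) pN]
    show ?thesis by (simp add: insert_commute)
  next
    \<comment> \<open>Here \<open>n\<close> is in \<open>N - M\<close>, and a single exchange in
      \<open>M\<close> turns \<open>{n, m}\<close> into \<open>{n, p}\<close>.\<close>
    case False
    then have nN: "n \<in> N" and nW: "n \<in> W" using n NW by auto
    from modules_induced_exchange_pair[OF M mN'[OF nN] nW False mM pM]
    show ?thesis by (simp add: insert_commute)
  qed
qed

lemma modules_induced_sym_diff:
  assumes M: "M \<in> modules (induced H W)" and N: "N \<in> modules (induced H W)"
    and ne: "M \<inter> N \<noteq> {}" "M - N \<noteq> {}" "N - M \<noteq> {}"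
  shows "(M - N) \<union> (N - M) \<in> modules (induced H W)" (is "?D \<in> _")
proof (rule modules_inducedI)
  show "?D \<subseteq> W" using M N by (auto dest: modules_induced_subset)
next
  fix e m x
  assume e: "e \<in> edges H" "e \<subseteq> W" "m \<in> e" "m \<in> ?D" "x \<in> e" "x \<notin> ?D"
  show "e \<inter> ?D = {m} \<and> (\<forall>n\<in>?D. insert n (e - {m}) \<in> edges H)"
  proof (cases "e \<subseteq> M \<union> N")
    case False
    then obtain y where y: "y \<in> e" "y \<notin> M \<union> N" by blast
    have "W \<union> N = W" using modules_induced_subset[OF N] by blast
    then have U: "M \<union> N \<in> modules (induced H W)"
      using modules_induced_Un[OF M N subset_refl] ne(1) by auto
    have mU: "m \<in> M \<union> N" using e by blast
    \<comment> \<open>The edge leaves the module \<open>M \<union> N\<close>, so it meets the union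
      only in \<open>m\<close>, and the exchanges restrict to \<open>?D\<close>.\<close>
    show ?thesis
      using modules_induced_Int_eq[OF U e(1-3) mU y]
        modules_induced_exchange[OF U e(1-3) mU y] e(4) by blast
  next
    case True
    \<comment> \<open>A vertex of the union outside the symmetric difference is in the intersection,
      so \<open>e\<close> straddles; the position of \<open>m\<close> decides in which order the two
      modules are taken.\<close>
    then have x: "x \<in> M \<inter> N" using e by blast
    have "e = {m, x} \<and> (\<forall>n\<in>?D. {x, n} \<in> edges H)"
    proof (cases "m \<in> M")
      case m: True
      then have "m \<in> M - N" using e by blast
      from modules_induced_straddling_pair[OF M N ne(3) e(1) True e(3) this e(5) x]
      show ?thesis by blast
    next
      case False
      then have m: "m \<in> N - M" using e by blast
      have "e \<subseteq> N \<union> M" "x \<in> N \<inter> M" using True x by auto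
      from modules_induced_straddling_pair[OF N M ne(2) e(1) this(1) e(3) m e(5) this(2)]
      show ?thesis by blast
    qed
    moreover have "m \<noteq> x" using e by blast
    ultimately have "e = {m, x}" "e - {m} = {x}" "\<forall>n\<in>?D. {x, n} \<in> edges H" by auto
    then show ?thesis using e by (auto simp: insert_commute)
  qed
qed

section \<open>Partitivity and the five axioms\<close>

lemma partitive_family_modules_induced: "partitive_family W (modules (induced H W))"
proof -
  have "M \<union> N \<in> modules (induced H W)"
    if "M \<in> modules (induced H W)" "N \<in> modules (induced H W)" "M \<inter> N \<noteq> {}" for M N
  proof -
    \<comment> \<open>This makes the union lemma, applied with both ambient sets equal to
      \<open>W\<close>, a statement about modules of \<open>induced H W\<close>.\<close>
    have "W \<union> N = W" using modules_induced_subset[OF that(2)] by blast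
    then show ?thesis using modules_induced_Un[OF that(1,2) subset_refl] that(3) by auto
  qed
  then show ?thesis
    unfolding partitive_family_def
    by (auto simp: modules_induced_trivial modules_induced_Int modules_induced_sym_diff
        dest: modules_induced_subset)
qed

theorem proposition4:
  fixes H :: "'a hgraph"
  assumes "hypergraph H"
  shows "modular_covering (verts H) (\<lambda>W. modules (induced H W))"
  unfolding modular_covering_def
proof (intro conjI allI impI ballI)
  fix W W'
  assume "W \<subseteq> W' \<and> W' \<subseteq> verts H"
  then show "{M' \<inter> W |M'. M' \<in> modules (induced H W')} \<subseteq> modules (induced H W)"
    using modules_induced_restrict by blast
next
  fix W W'
  assume W: "W \<subseteq> W' \<and> W' \<subseteq> verts H \<and> W \<in> modules (induced H W')"
  then have W1: "W \<subseteq> W'" and W2: "W \<in> modules (induced H W')" by auto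
  have "M \<in> modules (induced H W)" if "M \<in> modules (induced H W')" "M \<subseteq> W" for M
    using modules_induced_restrict[OF that(1) W1] that(2) by (simp add: Int_absorb2)
  moreover have "M \<in> modules (induced H W') \<and> M \<subseteq> W" if "M \<in> modules (induced H W)" for M
    using modules_induced_trans[OF W2 that] modules_induced_subset[OF that] by simp
  ultimately show "{M' \<in> modules (induced H W'). M' \<subseteq> W} = modules (induced H W)"
    by blast
next
  fix W W' M M'
  assume W: "W \<subseteq> W' \<and> W' \<subseteq> verts H" and M: "M \<in> modules (induced H W)"
    and M': "M' \<in> modules (induced H W')" and MM': "M \<inter> M' = {} \<and> M' \<inter> W \<noteq> {}"
  then obtain p where "p \<in> M'" "p \<in> W" by auto
  with W MM' show "M \<in> modules (induced H (W \<union> M'))"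
    by (intro modules_induced_extend_disjoint[OF M M']) simp_all
next
  fix W W' M M'
  assume W: "W \<subseteq> W' \<and> W' \<subseteq> verts H" and M: "M \<in> modules (induced H W)"
    and M': "M' \<in> modules (induced H W')" and MM': "M \<inter> M' \<noteq> {}"
  then obtain p where "p \<in> M" "p \<in> M'" by auto
  with W show "M \<union> M' \<in> modules (induced H (W \<union> M'))"
    by (intro modules_induced_Un[OF M M']) simp_all
\<comment> \<open>The goal still open is (A1).\<close>
qed (rule partitive_family_modules_induced)

end
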